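(* Let $d\ge 1$ and let $p \in \mathbb{R}[x_1,\ldots,x_d]$. If $p$ is nonnegative on $[0,1]^d$, then $T_p$ has the Hausdorff moment property.
   Context: $\mathbb{N}_0$ denotes the set of nonnegative integers and $\mathcal{A}$ the set of all real sequences $\alpha=(\alpha_n)_{n\in\mathbb{N}_0}$. A sequence $\alpha\in\mathcal{A}$ is a Hausdorff moment sequence if there is a nonnegative Borel measure $\mu$ on $\mathbb{R}$ with $\operatorname{supp}(\mu)\subset[0,1]$ such that $\alpha_n=\int_{[0,1]} x^n\,d\mu$ for all $n\in\mathbb{N}_0$ (all these integrals existing). For a polynomial $p=\sum_{\boldsymbol{i}\in\mathbb{N}_0^d} p_{\boldsymbol{i}}\,x_1^{i_1}\cdots x_d^{i_d}\in\mathbb{R}[x_1,\ldots,x_d]$ (where $\boldsymbol{i}=(i_1,\ldots,i_d)$), the map $T_p:\mathcal{A}\to\mathcal{A}$ is defined by $T_p(\alpha)=(\tilde\alpha_n)_{n\in\mathbb{N}_0}$ with $\tilde\alpha_n=\sum_{\boldsymbol{i}} p_{\boldsymbol{i}}\,\alpha_{n+i_1}\alpha_{n+i_2}\cdots\alpha_{n+i_d}$. $T_p$ has the Hausdorff moment property if, for every Hausdorff moment sequence $\alpha$, the sequence $T_p(\alpha)$ is a Hausdorff moment sequence. *)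

theory Defs
  imports "HOL-Analysis.Analysis" "HOL-Library.Poly_Mapping"
begin

text \<open>Real polynomials in the indeterminates \<open>x\<^sub>0, ..., x\<^sub>d\<^sub>-\<^sub>1\<close> are elements of the monoid algebra of
  exponent vectors: a polynomial maps each exponent vector to its coefficient. Indices run from
  \<open>0\<close> to \<open>d - 1\<close>. The exponent vectors of a polynomial in \<open>d\<close> indeterminates vanish outside
  \<open>{..<d}\<close>.\<close>

type_synonym real_mpoly = "(nat \<Rightarrow>\<^sub>0 nat) \<Rightarrow>\<^sub>0 real"

definition mpolys :: "nat \<Rightarrow> real_mpoly set" where
  "mpolys d = {p. \<forall>i\<in>Poly_Mapping.keys p. Poly_Mapping.keys i \<subseteq> {..<d}}"

definition mpoly_eval :: "nat \<Rightarrow> real_mpoly \<Rightarrow> (nat \<Rightarrow> real) \<Rightarrow> real" where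
  "mpoly_eval d p x =
    (\<Sum>i\<in>Poly_Mapping.keys p.
      Poly_Mapping.lookup p i * (\<Prod>j<d. x j ^ Poly_Mapping.lookup i j))"

definition measure_support :: "'a::topological_space measure \<Rightarrow> 'a set" where
  "measure_support \<mu> = {x. \<forall>U. open U \<longrightarrow> x \<in> U \<longrightarrow> emeasure \<mu> U > 0}"

definition hausdorff_moment_sequence :: "(nat \<Rightarrow> real) \<Rightarrow> bool" where
  "hausdorff_moment_sequence \<alpha> \<longleftrightarrow>
    (\<exists>\<mu>::real measure. sets \<mu> = sets borel \<and> measure_support \<mu> \<subseteq> {0..1} \<and>
      (\<forall>n. set_integrable \<mu> {0..1} (\<lambda>x. x ^ n) \<and> \<alpha> n = (LINT x:{0..1}|\<mu>. x ^ n)))"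

text \<open>The product runs over all \<open>j < d\<close>, including those with \<open>i\<^sub>j = 0\<close>, which contribute the
  factor \<open>\<alpha>\<^sub>n\<close>. So the operator depends on \<open>d\<close> and not only on the polynomial.\<close>

definition moment_transform ::
    "nat \<Rightarrow> real_mpoly \<Rightarrow> (nat \<Rightarrow> real) \<Rightarrow> (nat \<Rightarrow> real)" where
  "moment_transform d p \<alpha> =
    (\<lambda>n. \<Sum>i\<in>Poly_Mapping.keys p.
      Poly_Mapping.lookup p i * (\<Prod>j<d. \<alpha> (n + Poly_Mapping.lookup i j)))"

definition hausdorff_moment_property :: "((nat \<Rightarrow> real) \<Rightarrow> (nat \<Rightarrow> real)) \<Rightarrow> bool" where
  "hausdorff_moment_property T \<longleftrightarrow>
    (\<forall>\<alpha>. hausdorff_moment_sequence \<alpha> \<longrightarrow> hausdorff_moment_sequence (T \<alpha>))"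

end

theory Submission
  imports Defs
begin

text \<open>Let \<open>\<mu>\<close> represent \<open>\<alpha>\<close> on \<open>[0,1]\<close>. On the cube \<open>[0,1]\<^sup>d\<close> take the product measure \<open>\<mu>\<^sup>d\<close> with the
  nonnegative density \<open>p\<close>, and push it forward under \<open>x \<mapsto> x\<^sub>1 \<cdots> x\<^sub>d\<close>. By Fubini, the \<open>n\<close>-th
  moment of the image is \<open>\<integral> p(x) (x\<^sub>1 \<cdots> x\<^sub>d)\<^sup>n d\<mu>\<^sup>d = \<Sum>\<^sub>i p\<^sub>i \<Prod>\<^sub>j \<alpha>(n + i\<^sub>j)\<close>.\<close>

text \<open>The representing measure is the image under \<open>g\<close> of \<open>P\<close>
  weighted by \<open>q\<close>. Points where \<open>g\<close> leaves [0,1] carry no weight, so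
  \<open>q\<close> can do the cutting off and \<open>P\<close> may live on a larger space than the
  cube.\<close>

lemma hausdorff_moment_sequenceI_weighted_image:
  fixes P :: "'a measure" and g q :: "'a \<Rightarrow> real"
  assumes g[measurable]: "g \<in> borel_measurable P"
    and q[measurable]: "q \<in> borel_measurable P"
    and nonneg: "\<And>x. 0 \<le> q x"
    and range: "\<And>x. q x \<noteq> 0 \<Longrightarrow> g x \<in> {0..1}"
    and moments: "\<And>n. has_bochner_integral P (\<lambda>x. q x * g x ^ n) (\<alpha> n)"
  shows "hausdorff_moment_sequence \<alpha>"
  unfolding hausdorff_moment_sequence_def
proof (intro exI conjI allI)
  let ?\<nu> = "distr (density P (\<lambda>x. ennreal (q x))) borel g"
  show "sets ?\<nu> = sets borel" by simp
  \<comment> \<open>Integrals over [0,1] against the image measure pull back to \<open>P\<close>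
    with an extra indicator, which the weight absorbs.\<close>
  have *: "q x * (indicator {0..1} (g x) * g x ^ n) = q x * g x ^ n" for x n
    using range[of x] by (cases "q x = 0") auto
  have null: "emeasure ?\<nu> (- {0..1}) = 0"
  proof -
    have eq: "ennreal (q x) * indicator (g -` (- {0..1}) \<inter> space P) x = 0" for x
      using range[of x] by (cases "q x = 0") auto
    show ?thesis
      by (subst emeasure_distr) (auto simp: emeasure_density eq)
  qed
  show "measure_support ?\<nu> \<subseteq> {0..1}"
  proof
    fix x assume x: "x \<in> measure_support ?\<nu>"
    show "x \<in> {0..1}"
    proof (rule ccontr)
      assume "x \<notin> {0..1}"
      moreover have "open (- {0..1::real})"
        by (intro open_Compl) simp
      ultimately have "emeasure ?\<nu> (- {0..1}) > 0"
        using x unfolding measure_support_def by blast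
      with null show False by simp
    qed
  qed
  fix n
  show "set_integrable ?\<nu> {0..1} (\<lambda>x. x ^ n)"
    using moments[of n] nonneg unfolding set_integrable_def
    by (subst integrable_distr_eq)
      (auto simp: integrable_density * has_bochner_integral_iff)
  show "\<alpha> n = (LINT x:{0..1}|?\<nu>. x ^ n)"
    using moments[of n] nonneg unfolding set_lebesgue_integral_def
    by (subst integral_distr)
      (auto simp: integral_density * has_bochner_integral_iff)
qed

lemma (in product_sigma_finite) has_bochner_integral_prod:
  fixes f :: "'i \<Rightarrow> 'a \<Rightarrow> real"
  assumes "finite I" and "\<And>i. i \<in> I \<Longrightarrow> has_bochner_integral (M i) (f i) (a i)"
  shows "has_bochner_integral (Pi\<^sub>M I M) (\<lambda>x. \<Prod>i\<in>I. f i (x i)) (\<Prod>i\<in>I. a i)"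
  using assms product_integrable_prod[of I f] product_integral_prod[of I f]
  by (auto simp: has_bochner_integral_iff)

theorem corollary4p3:
  fixes d :: nat and p :: real_mpoly
  assumes "d \<ge> 1"
    and "p \<in> mpolys d"
    and "\<And>x :: nat \<Rightarrow> real. (\<forall>j<d. x j \<in> {0..1}) \<Longrightarrow> mpoly_eval d p x \<ge> 0"
  shows "hausdorff_moment_property (moment_transform d p)"
  unfolding hausdorff_moment_property_def
proof (intro allI impI)
  fix \<alpha> assume "hausdorff_moment_sequence \<alpha>"
  then obtain \<mu> :: "real measure" where sets_\<mu>[measurable_cong]: "sets \<mu> = sets borel"
    and int: "\<And>n. set_integrable \<mu> {0..1} (\<lambda>x. x ^ n)"
    and \<alpha>: "\<And>n. \<alpha> n = (LINT x:{0..1}|\<mu>. x ^ n)"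
    unfolding hausdorff_moment_sequence_def by blast
  \<comment> \<open>The total mass of the restriction of \<mu> to [0,1] is the zeroth moment, hence
    finite; this makes product measures and Fubini available.\<close>
  define N where "N = density \<mu> (indicator {0..1})"
  have sets_N[measurable_cong]: "sets N = sets borel"
    by (simp add: N_def sets_\<mu>)
  have "emeasure \<mu> {0..1} < \<infinity>"
    using int[of 0] sets_\<mu>
    by (auto simp: set_integrable_def integrable_indicator_iff space_borel dest: sets_eq_imp_space_eq)
  then interpret N: finite_measure N
    using sets_\<mu> by (intro finite_measureI) (auto simp: N_def emeasure_density
        dest: sets_eq_imp_space_eq)
  interpret product_sigma_finite "\<lambda>_::nat. N"
    by unfold_locales
  let ?P = "Pi\<^sub>M {..<d} (\<lambda>_. N)"
  let ?g = "\<lambda>x :: nat \<Rightarrow> real. \<Prod>j<d. x j"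
  \<comment> \<open>The space of \<open>?P\<close> is larger than the cube, while \<open>p\<close>
    is only known to be nonnegative on the cube. The cutoff \<open>c\<close> makes \<open>q\<close>
    nonnegative everywhere, and its product form gives one factor to each coordinate.\<close>
  define c where "c = (\<lambda>x :: nat \<Rightarrow> real. \<Prod>j<d. indicator {0..1} (x j) :: real)"
  define q where "q = (\<lambda>x. c x * mpoly_eval d p x)"
  have N: "has_bochner_integral N (\<lambda>x. indicator {0..1} x * x ^ n) (\<alpha> n)" for n
  proof -
    have "has_bochner_integral \<mu> (\<lambda>x. indicator {0..1} x * x ^ n) (\<alpha> n)"
      using int[of n] \<alpha>[of n]
      by (simp add: has_bochner_integral_iff set_integrable_def set_lebesgue_integral_def)
    \<comment> \<open>The indicator is idempotent: one copy becomes the density of \<open>N\<close>,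
      the other stays in the integrand to match a factor of \<open>c\<close>.\<close>
    then have "has_bochner_integral \<mu>
        (\<lambda>x. indicator {0..1} x *\<^sub>R (indicator {0..1} x * x ^ n)) (\<alpha> n)"
      by (rule back_subst[where P = "\<lambda>f. has_bochner_integral \<mu> f _"])
        (auto simp: fun_eq_iff indicator_def)
    then have "has_bochner_integral (density \<mu> (\<lambda>x. ennreal (indicator {0..1} x)))
        (\<lambda>x. indicator {0..1} x * x ^ n) (\<alpha> n)"
      by (intro has_bochner_integral_density) auto
    then show ?thesis by (simp add: N_def ennreal_indicator)
  qed
  have c_zero: "c x = 0" if "\<not> (\<forall>j<d. x j \<in> {0..1})" for x
    using that by (auto simp: c_def indicator_def prod_zero_iff)
  \<comment> \<open>Each summand separates into one function per coordinate, with integral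
    \<alpha>(n + i_j) against \<open>N\<close>. A coordinate with exponent 0 still carries x_j^n
    from the power of \<open>?g\<close>, hence the factor \<alpha>(n).\<close>
  have expand: "q x * ?g x ^ n =
      (\<Sum>i\<in>Poly_Mapping.keys p. Poly_Mapping.lookup p i *
        (\<Prod>j<d. indicator {0..1} (x j) * x j ^ (n + Poly_Mapping.lookup i j)))" for x n
    by (simp add: q_def c_def mpoly_eval_def sum_distrib_left sum_distrib_right
        prod.distrib prod_power_distrib power_add mult_ac)
  show "hausdorff_moment_sequence (moment_transform d p \<alpha>)"
  proof (rule hausdorff_moment_sequenceI_weighted_image)
    show "?g \<in> borel_measurable ?P" by measurable
    show "q \<in> borel_measurable ?P"
      unfolding q_def c_def mpoly_eval_def by measurable
    show "0 \<le> q x" for x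
    proof (cases "\<forall>j<d. x j \<in> {0..1}")
      case True
      with assms(3) have "0 \<le> mpoly_eval d p x" by blast
      then show ?thesis by (simp add: q_def c_def prod_nonneg)
    next
      case False
      then show ?thesis by (simp add: q_def c_zero)
    qed
    show "?g x \<in> {0..1}" if "q x \<noteq> 0" for x
    proof -
      have "\<forall>j<d. x j \<in> {0..1}" using that c_zero[of x] by (auto simp: q_def)
      then show ?thesis by (auto intro!: prod_nonneg prod_le_1)
    qed
    show "has_bochner_integral ?P (\<lambda>x. q x * ?g x ^ n) (moment_transform d p \<alpha> n)" for n
      unfolding expand moment_transform_def
      by (intro has_bochner_integral_sum has_bochner_integral_mult_right
          has_bochner_integral_prod N finite_lessThan)
  qed
qed

end
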